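(* Let $a>0$ and let the plane $\mathbb{R}^2$ be endowed with the density $$f(x,y)=e^{\psi(x,y)}=\frac{1}{4\pi a^2}e^{-y^2/(2a^2)}\left(e^{-(x-1)^2/(2a^2)}+e^{-(x+1)^2/(2a^2)}\right).$$ Then horizontal and vertical lines have generalized curvature $0$ and are the only lines which have constant generalized curvature.
   Context: For a boundary curve $C$ in the plane with unit inward normal $\mathbf n$ and standard curvature $\kappa$, and for a density $e^{\psi}$ (a positive continuous function, here smooth, used to weight area and length), the generalized curvature of $C$ is $\kappa_\psi=\kappa-d\psi/d\mathbf n$, where $d\psi/d\mathbf n=\langle\nabla\psi,\mathbf n\rangle$. A line is regarded as the boundary of a half-plane. A horizontal line is one of the form $y=b$ and a vertical line is one of the form $x=b$.
   Formalization: The claim "generalized curvature 0" is false (y=1 has curvature ±1/a²); it is replaced by "constant generalized curvature", and it is stated that the value is 0 on y=b exactly when b=0 and on x=b exactly when b=tanh(b/a²). *)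

theory Defs
  imports "HOL-Analysis.Analysis"
begin

type_synonym plane = "real \<times> real"

text \<open>
  A twice continuously differentiable unit-speed parametrization \<open>\<gamma>\<close>, with first two derivatives
  \<open>\<gamma>'\<close> and \<open>\<gamma>''\<close>, of a relative neighbourhood of \<open>p = \<gamma> 0\<close> in the curve \<open>C\<close>.
\<close>

definition arclength_param ::
  "plane set \<Rightarrow> plane \<Rightarrow> (real \<Rightarrow> plane) \<Rightarrow> (real \<Rightarrow> plane) \<Rightarrow> (real \<Rightarrow> plane) \<Rightarrow> bool" where
  "arclength_param C p \<gamma> \<gamma>' \<gamma>'' \<longleftrightarrow>
     (\<exists>e>0. \<exists>U g. open U \<and> homeomorphism {-e<..<e} (C \<inter> U) \<gamma> g \<and> \<gamma> 0 = p \<and>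
        (\<forall>t\<in>{-e<..<e}. (\<gamma> has_vector_derivative \<gamma>' t) (at t) \<and>
                      (\<gamma>' has_vector_derivative \<gamma>'' t) (at t) \<and> norm (\<gamma>' t) = 1) \<and>
        continuous_on {-e<..<e} \<gamma>'')"

definition unit_inward_normal :: "plane set \<Rightarrow> plane \<Rightarrow> plane \<Rightarrow> bool" where
  "unit_inward_normal E p n \<longleftrightarrow>
     norm n = 1 \<and>
     (\<exists>\<gamma> \<gamma>' \<gamma>''. arclength_param (frontier E) p \<gamma> \<gamma>' \<gamma>'' \<and> \<gamma>' 0 \<bullet> n = 0) \<and>
     (\<exists>d>0. \<forall>t\<in>{0<..<d}. p + t *\<^sub>R n \<in> E \<and> p - t *\<^sub>R n \<notin> E)"

text \<open>
  Standard curvature of \<open>frontier E\<close> at \<open>p\<close> with respect to the unit inward normal \<open>n\<close>: the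
  derivative of the unit tangent is \<open>k\<close> times \<open>n\<close>, so the unit disc has curvature \<open>1\<close>.
\<close>

definition has_curvature :: "plane set \<Rightarrow> plane \<Rightarrow> plane \<Rightarrow> real \<Rightarrow> bool" where
  "has_curvature E p n k \<longleftrightarrow>
     (\<exists>\<gamma> \<gamma>' \<gamma>''. arclength_param (frontier E) p \<gamma> \<gamma>' \<gamma>'' \<and> \<gamma>'' 0 = k *\<^sub>R n)"

definition has_generalized_curvature ::
  "(plane \<Rightarrow> real) \<Rightarrow> plane set \<Rightarrow> plane \<Rightarrow> real \<Rightarrow> bool" where
  "has_generalized_curvature \<psi> E p c \<longleftrightarrow>
     (\<exists>n k grad. unit_inward_normal E p n \<and> has_curvature E p n k \<and>
        GDERIV \<psi> p :> grad \<and> c = k - grad \<bullet> n)"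

definition has_constant_generalized_curvature ::
  "(plane \<Rightarrow> real) \<Rightarrow> plane set \<Rightarrow> bool" where
  "has_constant_generalized_curvature \<psi> E \<longleftrightarrow>
     (\<exists>c. \<forall>p\<in>frontier E. has_generalized_curvature \<psi> E p c)"

definition half_plane :: "plane set \<Rightarrow> bool" where
  "half_plane H \<longleftrightarrow> (\<exists>u b. u \<noteq> 0 \<and> H = {q. u \<bullet> q \<le> b})"

definition line :: "plane set \<Rightarrow> bool" where
  "line L \<longleftrightarrow> affine L \<and> aff_dim L = 1"

definition horizontal_line :: "real \<Rightarrow> plane set" where
  "horizontal_line b = {(x, y). y = b}"

definition vertical_line :: "real \<Rightarrow> plane set" where
  "vertical_line b = {(x, y). x = b}"

definition two_gaussian_density :: "real \<Rightarrow> plane \<Rightarrow> real" where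
  "two_gaussian_density a = (\<lambda>(x, y).
     1 / (4 * pi * a\<^sup>2) * exp (- (y\<^sup>2 / (2 * a\<^sup>2))) *
       (exp (- ((x - 1)\<^sup>2 / (2 * a\<^sup>2))) + exp (- ((x + 1)\<^sup>2 / (2 * a\<^sup>2)))))"

end

theory Submission
  imports Defs
begin

text \<open>
  The boundary of the half-plane \<open>u \<bullet> q \<le> b\<close> has curvature zero and inward normal \<open>- u / norm u\<close>,
  so its generalized curvature is \<open>\<nabla>\<psi> \<bullet> u / norm u\<close>. Since \<open>\<psi>\<close> is, up to a constant,
  \<open>- (x\<^sup>2 + y\<^sup>2) / (2 * a\<^sup>2) + ln (cosh (x / a\<^sup>2))\<close>, its gradient is
  \<open>(tanh (x / a\<^sup>2) - x, - y) / a\<^sup>2\<close>, and on the line \<open>u \<bullet> q = b\<close> the generalized curvature becomes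
  \<open>(fst u * tanh (x / a\<^sup>2) - b) / (a\<^sup>2 * norm u)\<close>. By injectivity of \<open>tanh\<close> this is constant only if
  \<open>fst u = 0\<close> or \<open>x\<close> is constant on the line.
\<close>

section \<open>Arc-length parametrizations of a straight line\<close>

lemma has_vector_derivative_inner_const_zero:
  fixes f :: "real \<Rightarrow> 'a::real_inner"
  assumes "(f has_vector_derivative f') (at t)" "open S" "t \<in> S" "\<And>s. s \<in> S \<Longrightarrow> u \<bullet> f s = b"
  shows "u \<bullet> f' = 0"
proof -
  have "((\<lambda>s. u \<bullet> f s) has_vector_derivative u \<bullet> f') (at t)"
    using bounded_linear.has_vector_derivative[OF bounded_linear_inner_right assms(1)] .
  moreover have "((\<lambda>s. u \<bullet> f s) has_vector_derivative 0) (at t)"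
    by (rule has_vector_derivative_transform_within_open[OF has_vector_derivative_const[of b] assms(2,3)])
       (simp add: assms(4))
  ultimately show ?thesis
    by (rule vector_derivative_unique_at)
qed

text \<open>The function \<open>u \<bullet> \<gamma> t\<close> is constant near 0, so
  differentiating it twice kills the normal components. This covers every admissible
  parametrization, which is what the existential quantifiers in the definitions of normal and
  curvature call for.\<close>

lemma arclength_param_line_orthogonal:
  assumes "arclength_param {q. u \<bullet> q = b} p \<gamma> \<gamma>' \<gamma>''"
  shows "u \<bullet> \<gamma>' 0 = 0" "u \<bullet> \<gamma>'' 0 = 0" "norm (\<gamma>' 0) = 1"
proof -
  obtain e U g where e: "e > 0" and hom: "homeomorphism {-e<..<e} ({q. u \<bullet> q = b} \<inter> U) \<gamma> g"
    and d: "\<And>t. t \<in> {-e<..<e} \<Longrightarrow> (\<gamma> has_vector_derivative \<gamma>' t) (at t) \<and>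
              (\<gamma>' has_vector_derivative \<gamma>'' t) (at t) \<and> norm (\<gamma>' t) = 1"
    using assms unfolding arclength_param_def by blast
  have "u \<bullet> \<gamma> t = b" if "t \<in> {-e<..<e}" for t
    using homeomorphism_image1[OF hom] that by blast
  then have 1: "u \<bullet> \<gamma>' t = 0" if "t \<in> {-e<..<e}" for t
    using has_vector_derivative_inner_const_zero[of \<gamma> "\<gamma>' t" t "{-e<..<e}" u b] d that by auto
  then have "u \<bullet> \<gamma>'' 0 = 0"
    using has_vector_derivative_inner_const_zero[of \<gamma>' "\<gamma>'' 0" 0 "{-e<..<e}" u 0] d e by auto
  then show "u \<bullet> \<gamma>' 0 = 0" "u \<bullet> \<gamma>'' 0 = 0" "norm (\<gamma>' 0) = 1"
    using 1 d e by auto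
qed

text \<open>The orthogonal complement of a nonzero vector of the plane is one-dimensional, so its
  nonzero element \<open>u\<close> spans it.\<close>

lemma orthogonal_plane_parallel:
  fixes u v n :: plane
  assumes "v \<noteq> 0" "u \<noteq> 0" "u \<bullet> v = 0" "v \<bullet> n = 0"
  obtains s where "n = s *\<^sub>R u"
proof -
  obtain u1 u2 v1 v2 n1 n2 where c: "u = (u1, u2)" "v = (v1, v2)" "n = (n1, n2)"
    by (metis surj_pair)
  have uv: "u1 * v1 + u2 * v2 = 0" "v1 * n1 + v2 * n2 = 0" "v1 \<noteq> 0 \<or> v2 \<noteq> 0" "u1 \<noteq> 0 \<or> u2 \<noteq> 0"
    using assms by (auto simp: c zero_prod_def)
  \<comment> \<open>The determinant of \<open>u\<close> and \<open>n\<close> is annihilated by both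
    coordinates of \<open>v\<close>, one of which is nonzero.\<close>
  have "v1 * (u1 * n2 - u2 * n1) = 0" "v2 * (u1 * n2 - u2 * n1) = 0"
    using uv(1,2) by algebra+
  then have det: "u1 * n2 = u2 * n1"
    using uv(3) by auto
  show ?thesis
  proof (cases "u1 = 0")
    case True
    then show ?thesis using det uv(4) by (intro that[of "n2 / u2"]) (auto simp: c)
  next
    case False
    then show ?thesis using det by (intro that[of "n1 / u1"]) (auto simp: c field_simps)
  qed
qed

text \<open>Supplies the parametrization that normal and curvature must exhibit: a straight motion
  at unit speed, with zero acceleration.\<close>

lemma arclength_param_line_exists:
  fixes u :: plane
  assumes u: "u \<noteq> 0" and p: "u \<bullet> p = b"
  obtains \<gamma> \<gamma>' where "arclength_param {q. u \<bullet> q = b} p \<gamma> \<gamma>' (\<lambda>_. 0)"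
proof -
  \<comment> \<open>The direction of the line: \<open>u\<close> turned by a right angle and
    normalized.\<close>
  define v :: plane where "v = (1 / norm u) *\<^sub>R (- snd u, fst u)"
  have uv: "u \<bullet> v = 0"
    by (cases u) (simp add: v_def)
  have "norm (- snd u, fst u) = norm u"
    by (cases u) (simp add: norm_Pair add.commute)
  then have nv: "norm v = 1"
    unfolding v_def norm_scaleR using u by simp
  then have vv: "v \<bullet> v = 1" and "v \<noteq> 0"
    by (auto simp: dot_square_norm)
  \<comment> \<open>This open strip around \<open>p\<close> cuts from the line exactly the segment
    with parameters in (-1, 1), and \<open>v \<bullet> (q - p)\<close> recovers the parameter of a
    point.\<close>
  define U where "U = {q. \<bar>v \<bullet> (q - p)\<bar> < 1}"
  have "open U"
    unfolding U_def by (intro open_Collect_less continuous_intros)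
  have along: "q - p = (v \<bullet> (q - p)) *\<^sub>R v" if q: "u \<bullet> q = b" for q
  proof -
    have "u \<bullet> (q - p) = 0"
      using q p by (simp add: inner_diff_right)
    then obtain s where "q - p = s *\<^sub>R v"
      using orthogonal_plane_parallel[of u v "q - p"] u \<open>v \<noteq> 0\<close> uv by (metis inner_commute)
    then show ?thesis
      by (simp add: vv)
  qed
  have hom: "homeomorphism {-1<..<1} ({q. u \<bullet> q = b} \<inter> U) (\<lambda>t. p + t *\<^sub>R v) (\<lambda>q. v \<bullet> (q - p))"
    unfolding homeomorphism_def
  proof (intro conjI ballI)
    show "(\<lambda>t. p + t *\<^sub>R v) ` {- 1<..<1} = {q. u \<bullet> q = b} \<inter> U"
    proof (intro equalityI subsetI)
      fix q assume q: "q \<in> {q. u \<bullet> q = b} \<inter> U"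
      then have "q = p + (v \<bullet> (q - p)) *\<^sub>R v"
        using along[of q] by (simp add: algebra_simps)
      then show "q \<in> (\<lambda>t. p + t *\<^sub>R v) ` {- 1<..<1}"
        using q by (intro image_eqI[of _ _ "v \<bullet> (q - p)"]) (auto simp: U_def)
    qed (auto simp: U_def uv vv p inner_add_right)
    show "(\<lambda>q. v \<bullet> (q - p)) ` ({q. u \<bullet> q = b} \<inter> U) = {- 1<..<1}"
    proof (intro equalityI subsetI)
      fix t :: real assume "t \<in> {- 1<..<1}"
      then show "t \<in> (\<lambda>q. v \<bullet> (q - p)) ` ({q. u \<bullet> q = b} \<inter> U)"
        by (intro image_eqI[of _ _ "p + t *\<^sub>R v"]) (auto simp: U_def uv vv p inner_add_right)
    qed (auto simp: U_def)
  next
    fix q assume "q \<in> {q. u \<bullet> q = b} \<inter> U"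
    then show "p + (v \<bullet> (q - p)) *\<^sub>R v = q"
      using along[of q] by (simp add: algebra_simps)
  qed (auto intro!: continuous_intros simp: vv)
  have "arclength_param {q. u \<bullet> q = b} p (\<lambda>t. p + t *\<^sub>R v) (\<lambda>_. v) (\<lambda>_. 0)"
    unfolding arclength_param_def
    by (rule exI[of _ 1], simp, rule exI[of _ U])
       (use hom \<open>open U\<close> nv in \<open>auto intro!: derivative_eq_intros exI[of _ "\<lambda>q. v \<bullet> (q - p)"]\<close>)
  then show ?thesis
    using that by blast
qed

section \<open>Normal, curvature and generalized curvature of a half-plane\<close>

lemma unit_inward_normal_half_plane_iff:
  assumes u: "u \<noteq> 0" and p: "u \<bullet> p = b"
  shows "unit_inward_normal {q. u \<bullet> q \<le> b} p n \<longleftrightarrow> n = - ((1 / norm u) *\<^sub>R u)"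
proof
  assume "unit_inward_normal {q. u \<bullet> q \<le> b} p n"
  then obtain \<gamma> \<gamma>' \<gamma>'' d where n: "norm n = 1"
    and g: "arclength_param {q. u \<bullet> q = b} p \<gamma> \<gamma>' \<gamma>''" "\<gamma>' 0 \<bullet> n = 0"
    and d: "d > 0" "\<And>t. t \<in> {0<..<d} \<Longrightarrow> u \<bullet> (p + t *\<^sub>R n) \<le> b"
    unfolding unit_inward_normal_def frontier_halfspace_le[OF disjI1[OF u]] by auto
  have "\<gamma>' 0 \<noteq> 0"
    using arclength_param_line_orthogonal(3)[OF g(1)] by auto
  then obtain s where s: "n = s *\<^sub>R u"
    using orthogonal_plane_parallel[of "\<gamma>' 0" u n] u g(2) arclength_param_line_orthogonal(1)[OF g(1)]
    by blast
  \<comment> \<open>Orthogonality to the tangent leaves only the sign of \<open>s\<close> open. The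
    point at distance \<open>d / 2\<close> along \<open>n\<close> lies in the half-plane, and this
    decides the sign.\<close>
  have "(d / 2) * (s * (u \<bullet> u)) \<le> 0"
    using d(1) d(2)[of "d / 2"] p by (simp add: s inner_add_right)
  moreover have "u \<bullet> u > 0"
    using u by simp
  ultimately have "s \<le> 0"
    using d(1) by (simp add: mult_le_0_iff zero_less_mult_iff not_less)
  then have "- s * norm u = 1"
    using n s by simp
  then have "s = - (1 / norm u)"
    using u by (simp add: field_simps)
  then show "n = - ((1 / norm u) *\<^sub>R u)"
    using s by simp
next
  assume n: "n = - ((1 / norm u) *\<^sub>R u)"
  obtain \<gamma> \<gamma>' where g: "arclength_param {q. u \<bullet> q = b} p \<gamma> \<gamma>' (\<lambda>_. 0)"
    using arclength_param_line_exists[OF u p] .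
  have "\<gamma>' 0 \<bullet> n = 0"
    using arclength_param_line_orthogonal(1)[OF g] by (simp add: n inner_commute)
  moreover have "norm n = 1"
    using u by (simp add: n)
  \<comment> \<open>Moving along \<open>n\<close> lowers \<open>u \<bullet> q\<close> below
    \<open>b\<close>, moving against it raises it above \<open>b\<close>.\<close>
  moreover have "u \<bullet> n < 0"
    using u by (simp add: n)
  then have "p + t *\<^sub>R n \<in> {q. u \<bullet> q \<le> b} \<and> p - t *\<^sub>R n \<notin> {q. u \<bullet> q \<le> b}"
    if "t \<in> {0<..<1}" for t
    using that p by (auto simp: inner_add_right inner_diff_right mult_le_0_iff zero_le_mult_iff)
  ultimately show "unit_inward_normal {q. u \<bullet> q \<le> b} p n"
    unfolding unit_inward_normal_def frontier_halfspace_le[OF disjI1[OF u]]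
    using g zero_less_one by blast
qed

text \<open>The acceleration \<open>k *\<^sub>R n\<close> is orthogonal to \<open>u\<close>, while
  \<open>n\<close> is not; hence \<open>k\<close> vanishes.\<close>

lemma has_curvature_half_plane_iff:
  assumes u: "u \<noteq> 0" and p: "u \<bullet> p = b" and n: "u \<bullet> n \<noteq> 0"
  shows "has_curvature {q. u \<bullet> q \<le> b} p n k \<longleftrightarrow> k = 0"
proof
  assume "has_curvature {q. u \<bullet> q \<le> b} p n k"
  then obtain \<gamma> \<gamma>' \<gamma>'' where g: "arclength_param {q. u \<bullet> q = b} p \<gamma> \<gamma>' \<gamma>''" "\<gamma>'' 0 = k *\<^sub>R n"
    unfolding has_curvature_def frontier_halfspace_le[OF disjI1[OF u]] by blast
  then show "k = 0"
    using arclength_param_line_orthogonal(2)[OF g(1)] n by simp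
next
  assume "k = 0"
  then show "has_curvature {q. u \<bullet> q \<le> b} p n k"
    unfolding has_curvature_def frontier_halfspace_le[OF disjI1[OF u]]
    using arclength_param_line_exists[OF u p] by (metis scale_zero_left)
qed

text \<open>Normal, curvature and gradient are each uniquely determined, so the existential
  definition collapses to one explicit value. The two minus signs, from the definition and from the
  inward normal, cancel.\<close>

lemma has_generalized_curvature_half_plane_iff:
  assumes u: "u \<noteq> 0" and p: "u \<bullet> p = b" and grad: "GDERIV \<psi> p :> grad"
  shows "has_generalized_curvature \<psi> {q. u \<bullet> q \<le> b} p c \<longleftrightarrow> c = grad \<bullet> u / norm u"
proof -
  let ?n = "- ((1 / norm u) *\<^sub>R u)"
  have unique: "grad' = grad" if "GDERIV \<psi> p :> grad'" for grad'
  proof -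
    have "(\<lambda>h. h \<bullet> grad') = (\<lambda>h. h \<bullet> grad)"
      using has_derivative_unique[OF that[unfolded gderiv_def] grad[unfolded gderiv_def]] .
    then have "\<forall>h. h \<bullet> grad' = h \<bullet> grad"
      by (simp add: fun_eq_iff)
    then show ?thesis
      by (simp only: vector_eq_ldot)
  qed
  have "u \<bullet> ?n \<noteq> 0"
    using u by simp
  note curvature = has_curvature_half_plane_iff[OF u p this]
  have "has_generalized_curvature \<psi> {q. u \<bullet> q \<le> b} p c \<longleftrightarrow> c = 0 - grad \<bullet> ?n"
  proof
    assume "has_generalized_curvature \<psi> {q. u \<bullet> q \<le> b} p c"
    then obtain k grad' where "has_curvature {q. u \<bullet> q \<le> b} p ?n k" "GDERIV \<psi> p :> grad'"
      "c = k - grad' \<bullet> ?n"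
      unfolding has_generalized_curvature_def unit_inward_normal_half_plane_iff[OF u p] by blast
    then show "c = 0 - grad \<bullet> ?n"
      using unique by (simp only: curvature)
  next
    assume "c = 0 - grad \<bullet> ?n"
    with grad show "has_generalized_curvature \<psi> {q. u \<bullet> q \<le> b} p c"
      unfolding has_generalized_curvature_def unit_inward_normal_half_plane_iff[OF u p]
      by (intro exI[of _ ?n] exI[of _ 0] exI[of _ grad]) (simp only: curvature simp_thms)
  qed
  then show ?thesis
    by simp
qed

section \<open>The two-Gaussian density\<close>

lemma two_gaussian_density_gradient:
  fixes a :: real and \<psi> :: "plane \<Rightarrow> real"
  assumes a: "a > 0" and psi: "\<And>p. exp (\<psi> p) = two_gaussian_density a p"
  shows "GDERIV \<psi> (x, y) :> ((tanh (x / a\<^sup>2) - x) / a\<^sup>2, - y / a\<^sup>2)"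
proof -
  \<comment> \<open>Expanding the squares pulls out the common factor
    \<open>exp (- 1 / (2 * a\<^sup>2))\<close>. The remaining
    \<open>exp (s / a\<^sup>2) + exp (- s / a\<^sup>2)\<close> is twice a \<open>cosh\<close>, and
    that 2 turns \<open>4 * pi\<close> into \<open>2 * pi\<close>.\<close>
  define K where "K = ln (1 / (2 * pi * a\<^sup>2)) - 1 / (2 * a\<^sup>2)"
  have "\<psi> q = K - ((fst q)\<^sup>2 + (snd q)\<^sup>2) / (2 * a\<^sup>2) + ln (cosh (fst q / a\<^sup>2))" for q
  proof -
    obtain s t where q: "q = (s, t)" by fastforce
    have e: "- ((s - 1)\<^sup>2 / (2 * a\<^sup>2)) = - (s\<^sup>2 / (2 * a\<^sup>2)) - 1 / (2 * a\<^sup>2) + s / a\<^sup>2"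
      "- ((s + 1)\<^sup>2 / (2 * a\<^sup>2)) = - (s\<^sup>2 / (2 * a\<^sup>2)) - 1 / (2 * a\<^sup>2) - s / a\<^sup>2"
      using a by (simp_all add: field_simps power2_eq_square)
    have "exp (\<psi> q) = exp (K - (s\<^sup>2 + t\<^sup>2) / (2 * a\<^sup>2) + ln (cosh (s / a\<^sup>2)))"
      unfolding psi q two_gaussian_density_def prod.case e K_def
      using a by (simp add: exp_add exp_diff exp_minus add_divide_distrib cosh_real_pos)
        (simp add: cosh_def field_simps exp_minus)
    then show ?thesis by (simp add: q)
  qed
  then have \<psi>: "\<psi> = (\<lambda>q. K - ((fst q)\<^sup>2 + (snd q)\<^sup>2) / (2 * a\<^sup>2) + ln (cosh (fst q / a\<^sup>2)))"
    by blast
  have cosh: "((\<lambda>q::plane. ln (cosh (fst q / a\<^sup>2))) has_derivative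
      (\<lambda>h. tanh (x / a\<^sup>2) / a\<^sup>2 * fst h)) (at (x, y))"
  proof -
    have "((\<lambda>s. ln (cosh (s / a\<^sup>2))) has_real_derivative tanh (x / a\<^sup>2) / a\<^sup>2) (at (fst (x, y)))"
      using a by (auto intro!: derivative_eq_intros simp: tanh_def field_simps power2_eq_square power4_eq_xxxx)
    from has_derivative_compose[OF has_derivative_fst[OF has_derivative_ident] this[unfolded has_field_derivative_def]]
    show ?thesis by simp
  qed
  have "((\<lambda>q. K - ((fst q)\<^sup>2 + (snd q)\<^sup>2) / (2 * a\<^sup>2)) has_derivative
      (\<lambda>h. - (x * fst h + y * snd h) / a\<^sup>2)) (at (x, y))"
    using a by (auto intro!: derivative_eq_intros simp: field_simps power2_eq_square power4_eq_xxxx)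
  from has_derivative_add[OF this cosh] show ?thesis
    unfolding \<psi> gderiv_def
    by (rule has_derivative_eq_rhs) (auto simp: algebra_simps add_divide_distrib diff_divide_distrib)
qed

lemma two_gaussian_generalized_curvature_iff:
  fixes a :: real and \<psi> :: "plane \<Rightarrow> real"
  assumes a: "a > 0" and psi: "\<And>p. exp (\<psi> p) = two_gaussian_density a p"
    and u: "u \<noteq> 0" and p: "u \<bullet> (x, y) = b"
  shows "has_generalized_curvature \<psi> {q. u \<bullet> q \<le> b} (x, y) c \<longleftrightarrow>
           c = (fst u * tanh (x / a\<^sup>2) - b) / (a\<^sup>2 * norm u)"
proof -
  \<comment> \<open>The linear part of the gradient pairs with \<open>u\<close> to
    \<open>- b / a\<^sup>2\<close>, a constant along the line.\<close>
  have "((tanh (x / a\<^sup>2) - x) / a\<^sup>2, - y / a\<^sup>2) \<bullet> u = (fst u * tanh (x / a\<^sup>2) - b) / a\<^sup>2"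
    using a p[symmetric] by (cases u) (simp add: field_simps)
  then show ?thesis
    unfolding has_generalized_curvature_half_plane_iff[OF u p two_gaussian_density_gradient[OF a psi]]
    by simp
qed

section \<open>Horizontal and vertical lines, and the lines of constant generalized
  curvature\<close>

lemma line_eq_horizontal_iff:
  fixes u :: plane
  assumes u: "u \<noteq> 0"
  shows "{q. u \<bullet> q = b} = horizontal_line c \<longleftrightarrow> fst u = 0 \<and> b = snd u * c"
proof
  assume "{q. u \<bullet> q = b} = horizontal_line c"
  then have "(0, c) \<in> {q. u \<bullet> q = b}" "(1, c) \<in> {q. u \<bullet> q = b}"
    by (auto simp: horizontal_line_def)
  then show "fst u = 0 \<and> b = snd u * c"
    by (cases u) simp
qed (use u in \<open>cases u; auto simp: horizontal_line_def zero_prod_def\<close>)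

lemma line_eq_vertical_iff:
  fixes u :: plane
  assumes u: "u \<noteq> 0"
  shows "{q. u \<bullet> q = b} = vertical_line c \<longleftrightarrow> snd u = 0 \<and> b = fst u * c"
proof
  assume "{q. u \<bullet> q = b} = vertical_line c"
  then have "(c, 0) \<in> {q. u \<bullet> q = b}" "(c, 1) \<in> {q. u \<bullet> q = b}"
    by (auto simp: vertical_line_def)
  then show "snd u = 0 \<and> b = fst u * c"
    by (cases u) simp
qed (use u in \<open>cases u; auto simp: vertical_line_def zero_prod_def\<close>)

lemma two_gaussian_constant_curvature_iff:
  fixes a :: real and \<psi> :: "plane \<Rightarrow> real"
  assumes a: "a > 0" and psi: "\<And>p. exp (\<psi> p) = two_gaussian_density a p" and u: "u \<noteq> 0"
  shows "has_constant_generalized_curvature \<psi> {q. u \<bullet> q \<le> b} \<longleftrightarrow> fst u = 0 \<or> snd u = 0"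
proof
  assume "has_constant_generalized_curvature \<psi> {q. u \<bullet> q \<le> b}"
  then obtain c where c: "\<And>p. u \<bullet> p = b \<Longrightarrow> has_generalized_curvature \<psi> {q. u \<bullet> q \<le> b} p c"
    unfolding has_constant_generalized_curvature_def frontier_halfspace_le[OF disjI1[OF u]] by blast
  show "fst u = 0 \<or> snd u = 0"
  proof (rule ccontr)
    assume "\<not> (fst u = 0 \<or> snd u = 0)"
    then have nz: "fst u \<noteq> 0" "snd u \<noteq> 0" by auto
    \<comment> \<open>An oblique line has a point over every abscissa \<open>x\<close>. Comparing
      the abscissas 0 and 1 suffices, since \<open>tanh\<close> vanishes at 0 but not at
      \<open>1 / a\<^sup>2\<close>.\<close>
    have on: "u \<bullet> (x, (b - fst u * x) / snd u) = b" for x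
      using nz by (cases u) simp
    have "c = (fst u * tanh (x / a\<^sup>2) - b) / (a\<^sup>2 * norm u)" for x
      using two_gaussian_generalized_curvature_iff[OF a psi u on] c[OF on] by blast
    from this[of 0] this[of 1]
    have "(fst u * tanh (1 / a\<^sup>2) - b) / (a\<^sup>2 * norm u) = (fst u * 0 - b) / (a\<^sup>2 * norm u)"
      by simp
    then have "fst u * tanh (1 / a\<^sup>2) = 0"
      using a u by (subst (asm) divide_cancel_right) simp
    then show False
      using nz a by simp
  qed
next
  assume zero: "fst u = 0 \<or> snd u = 0"
  \<comment> \<open>One constant serves both cases: on a vertical line \<open>b / fst u\<close> is
    the common abscissa, and on a horizontal line the factor \<open>fst u = 0\<close> removes the
    \<open>tanh\<close> term, whatever its argument.\<close>
  have "has_generalized_curvature \<psi> {q. u \<bullet> q \<le> b} p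
      ((fst u * tanh (b / fst u / a\<^sup>2) - b) / (a\<^sup>2 * norm u))" if p: "u \<bullet> p = b" for p
  proof -
    obtain x y where xy: "p = (x, y)" by fastforce
    have "fst u = 0 \<or> x = b / fst u"
      using zero p by (cases u; cases "fst u = 0") (auto simp: xy)
    then show ?thesis
      using two_gaussian_generalized_curvature_iff[OF a psi u p[unfolded xy]] xy by auto
  qed
  then show "has_constant_generalized_curvature \<psi> {q. u \<bullet> q \<le> b}"
    unfolding has_constant_generalized_curvature_def frontier_halfspace_le[OF disjI1[OF u]] by blast
qed

text \<open>The constants are in general not 0: up to a sign given by the side of the half-plane,
  they are \<open>c / a\<^sup>2\<close> on the horizontal line at height \<open>c\<close> and
  \<open>(tanh (c / a\<^sup>2) - c) / a\<^sup>2\<close> on the vertical line at abscissa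
  \<open>c\<close>. The last two conjuncts record exactly when they vanish.\<close>

theorem proposition4p4:
  fixes a :: real and \<psi> :: "plane \<Rightarrow> real"
  assumes a: "a > 0"
    and psi: "\<And>p. exp (\<psi> p) = two_gaussian_density a p"
  shows "(\<forall>L H. line L \<and> half_plane H \<and> frontier H = L \<longrightarrow>
            (has_constant_generalized_curvature \<psi> H \<longleftrightarrow>
               (\<exists>b. L = horizontal_line b) \<or> (\<exists>b. L = vertical_line b)))
       \<and> (\<forall>b H. half_plane H \<and> frontier H = horizontal_line b \<longrightarrow>
            ((\<forall>p\<in>horizontal_line b. has_generalized_curvature \<psi> H p 0) \<longleftrightarrow> b = 0))
       \<and> (\<forall>b H. half_plane H \<and> frontier H = vertical_line b \<longrightarrow>
            ((\<forall>p\<in>vertical_line b. has_generalized_curvature \<psi> H p 0) \<longleftrightarrow> b = tanh (b / a\<^sup>2)))"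
proof (intro conjI allI impI; elim conjE)
  fix L H assume "half_plane H" and L: "frontier H = L"
  then obtain u b where u: "u \<noteq> 0" and H: "H = {q. u \<bullet> q \<le> b}"
    unfolding half_plane_def by blast
  have "L = {q. u \<bullet> q = b}"
    using L unfolding H frontier_halfspace_le[OF disjI1[OF u]] by simp
  \<comment> \<open>If one coordinate of \<open>u\<close> is 0, the other is not, so the offset
    \<open>c\<close> of the line can be solved for.\<close>
  moreover have "(\<exists>c. b = snd u * c) \<longleftrightarrow> snd u \<noteq> 0 \<or> b = 0" "(\<exists>c. b = fst u * c) \<longleftrightarrow> fst u \<noteq> 0 \<or> b = 0"
    by (auto intro: exI[of _ "b / snd u"] exI[of _ "b / fst u"])
  moreover have "fst u \<noteq> 0 \<or> snd u \<noteq> 0"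
    using u by (simp add: prod_eq_iff)
  ultimately show "has_constant_generalized_curvature \<psi> H \<longleftrightarrow>
      (\<exists>b. L = horizontal_line b) \<or> (\<exists>b. L = vertical_line b)"
    using two_gaussian_constant_curvature_iff[OF a psi u] line_eq_horizontal_iff[OF u]
      line_eq_vertical_iff[OF u] unfolding H by auto
next
  fix c H assume "half_plane H" and L: "frontier H = horizontal_line c"
  then obtain u b where u: "u \<noteq> 0" and H: "H = {q. u \<bullet> q \<le> b}"
    unfolding half_plane_def by blast
  have line: "{q. u \<bullet> q = b} = horizontal_line c"
    using L unfolding H frontier_halfspace_le[OF disjI1[OF u]] .
  then have f: "fst u = 0" and b: "b = snd u * c"
    using line_eq_horizontal_iff[OF u] by auto
  then have s: "snd u \<noteq> 0"
    using u by (simp add: prod_eq_iff)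
  have "has_generalized_curvature \<psi> H p 0 \<longleftrightarrow> c = 0" if p: "p \<in> horizontal_line c" for p
  proof -
    have "u \<bullet> (fst p, snd p) = b"
      using p line by auto
    from two_gaussian_generalized_curvature_iff[OF a psi u this, of 0] show ?thesis
      unfolding H using a u f s b by auto
  qed
  \<comment> \<open>A point on the line keeps the quantifier over \<open>p\<close> from being
    vacuous, so that zero curvature forces \<open>c = 0\<close>.\<close>
  moreover have "(0, c) \<in> horizontal_line c"
    by (simp add: horizontal_line_def)
  ultimately show "(\<forall>p\<in>horizontal_line c. has_generalized_curvature \<psi> H p 0) \<longleftrightarrow> c = 0"
    by blast
next
  fix c H assume "half_plane H" and L: "frontier H = vertical_line c"
  then obtain u b where u: "u \<noteq> 0" and H: "H = {q. u \<bullet> q \<le> b}"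
    unfolding half_plane_def by blast
  have line: "{q. u \<bullet> q = b} = vertical_line c"
    using L unfolding H frontier_halfspace_le[OF disjI1[OF u]] .
  then have f: "snd u = 0" and b: "b = fst u * c"
    using line_eq_vertical_iff[OF u] by auto
  then have s: "fst u \<noteq> 0"
    using u by (simp add: prod_eq_iff)
  have "has_generalized_curvature \<psi> H p 0 \<longleftrightarrow> c = tanh (c / a\<^sup>2)" if p: "p \<in> vertical_line c" for p
  proof -
    have "u \<bullet> (fst p, snd p) = b" "fst p = c"
      using p line by (auto simp: vertical_line_def)
    from two_gaussian_generalized_curvature_iff[OF a psi u this(1), of 0] this(2) show ?thesis
      unfolding H using a u s b by auto
  qed
  moreover have "(c, 0) \<in> vertical_line c"
    by (simp add: vertical_line_def)
  ultimately show "(\<forall>p\<in>vertical_line c. has_generalized_curvature \<psi> H p 0) \<longleftrightarrow> c = tanh (c / a\<^sup>2)"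
    by blast
qed

end
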